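(* The weights $\mathbf{w}^{(n)}_t$ in the ESQL algorithm (described in the context, with $K$ environments) converge to the following final weights: $$\mathbf{w}^{(n)}=\frac{\exp\Bigl(\frac{1}{|\mathcal{S}|}\sum_{j=1}^{|\mathcal{S}|}\mathbf{1}\bigl(\boldsymbol{\pi}^{(1)}(j)=\boldsymbol{\pi}^{(n)}(j)\bigr)\Bigr)}{\sum_{i=1}^K\exp\Bigl(\frac{1}{|\mathcal{S}|}\sum_{j=1}^{|\mathcal{S}|}\mathbf{1}\bigl(\boldsymbol{\pi}^{(1)}(j)=\boldsymbol{\pi}^{(i)}(j)\bigr)\Bigr)},$$ where, for all $n$, $$\boldsymbol{\pi}^{(n)}=\underset{\boldsymbol{\mu}}{\arg\min}\,\bigl(\mathbf{I}-\gamma\tilde{\mathbf{L}}^{(n)}_{\boldsymbol{\mu}}\bigr)^{-1}\mathbf{c}_{\boldsymbol{\mu}},$$ $\boldsymbol{\mu}$ ranges over deterministic stationary policies, and $\tilde{\mathbf{L}}^{(n)}_{\boldsymbol{\mu}}$ is the $\ell_1$-normalized version of $\mathbf{L}^{(n)}_{\boldsymbol{\mu}}$ (see context).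
   Context: Let $\mathcal{S}=\{1,\dots,|\mathcal{S}|\}$ and $\mathcal{A}$ be finite state and action spaces and $\gamma\in(0,1)$ a discount factor. For each action $a\in\mathcal{A}$ let $\mathbf{P}_a$ be the row-stochastic transition matrix of the original environment (in practice replaced by its estimate) and $\mathbf{c}_a\in\mathbb{R}^{|\mathcal{S}|}$ the cost vector with entries $c_a(s)$. Set $\mathbf{L}^{(1)}_a=\mathbf{P}_a$ and, for $n\ge2$, $$\mathbf{L}^{(n)}_a=\sum_{k=0}^{n-2}\Bigl(\mathbf{P}_a^{\,n-k-1}(\mathbf{P}_a^{T})^{k+1}+(\mathbf{P}_a^{T})^{n-k-1}\mathbf{P}_a^{\,k+1}\Bigr).$$ The $\ell_1$ normalization divides each row by its sum, so that the matrix is row-stochastic. For a deterministic stationary policy $\boldsymbol{\mu}:\mathcal{S}\to\mathcal{A}$, $\mathbf{L}^{(n)}_{\boldsymbol{\mu}}$ is the matrix whose $s$-th row is the $s$-th row of $\mathbf{L}^{(n)}_{\boldsymbol{\mu}(s)}$, and $\mathbf{c}_{\boldsymbol{\mu}}(s)=c_{\boldsymbol{\mu}(s)}(s)$; thus $(\mathbf{I}-\gamma\tilde{\mathbf{L}}^{(n)}_{\boldsymbol{\mu}})^{-1}\mathbf{c}_{\boldsymbol{\mu}}$ is the discounted-cost value function of $\boldsymbol{\mu}$ in the $n$-th environment $\mathcal{M}^{(n)}$, the infinite-horizon $\gamma$-discounted cost MDP with transition matrices given by the normalized $\mathbf{L}^{(n)}_a$ and costs $c_a(s)$. ESQL (Ensemble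 Synthetic $Q$-Learning) runs $Q$-learning in parallel on $\mathcal{M}^{(1)},\dots,\mathcal{M}^{(K)}$, producing $Q$-tables $\mathbf{Q}^{(n)}_t$. At each time $t$ it forms the greedy policies $\boldsymbol{\pi}^{(n)}_t(s)=\operatorname{argmin}_{a'}\mathbf{Q}^{(n)}_t(s,a')$, computes the rates $\frac1{|\mathcal{S}|}\sum_{j=1}^{|\mathcal{S}|}\mathbf{1}(\boldsymbol{\pi}^{(1)}_t(j)=\boldsymbol{\pi}^{(n)}_t(j))$, $n=1,\dots,K$, and sets $(\mathbf{w}^{(1)}_t,\dots,\mathbf{w}^{(K)}_t)$ equal to the softmax of the vector of these rates, where $\operatorname{softmax}(x)_n=e^{x_n}/\sum_{i=1}^K e^{x_i}$. As background, $Q$-learning iterates converge with probability one to the optimal $Q$-functions under the usual necessary conditions.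
   Formalization: It is additionally assumed that in each of the K environments at most one deterministic stationary policy attains the argmin; with ties, π^(n) is ill-defined and the greedy policies, hence the weights, can oscillate forever. *)

theory Defs
  imports "HOL-Probability.Probability"
begin

definition row_stochastic :: "real^'s^'s \<Rightarrow> bool" where
  "row_stochastic A \<longleftrightarrow> (\<forall>i j. 0 \<le> A $ i $ j) \<and> (\<forall>i. (\<Sum>j\<in>UNIV. A $ i $ j) = 1)"

text \<open>The type class power on vectors and matrices is componentwise, so powers with respect to
  the matrix product need a separate constant.\<close>

primrec matpow :: "real^'s^'s \<Rightarrow> nat \<Rightarrow> real^'s^'s" where
  "matpow A 0 = mat 1"
| "matpow A (Suc k) = A ** matpow A k"

text \<open>Only the values at \<open>n \<ge> 1\<close> are meaningful.\<close>

definition synth :: "real^'s^'s \<Rightarrow> nat \<Rightarrow> real^'s^'s" where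
  "synth A n = (if n = 1 then A
     else (\<Sum>k = 0..n - 2.
             matpow A (n - k - 1) ** matpow (transpose A) (k + 1)
           + matpow (transpose A) (n - k - 1) ** matpow A (k + 1)))"

definition l1_normalize :: "real^'s^'s \<Rightarrow> real^'s^'s" where
  "l1_normalize A = (\<chi> i j. A $ i $ j / (\<Sum>k\<in>UNIV. A $ i $ k))"

text \<open>Transition matrices of the \<open>n\<close>-th environment.\<close>

definition env_trans :: "('a \<Rightarrow> real^'s^'s) \<Rightarrow> nat \<Rightarrow> 'a \<Rightarrow> real^'s^'s" where
  "env_trans P n a = l1_normalize (synth (P a) n)"

definition synth_policy :: "('a \<Rightarrow> real^'s^'s) \<Rightarrow> nat \<Rightarrow> ('s \<Rightarrow> 'a) \<Rightarrow> real^'s^'s" where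
  "synth_policy P n \<mu> = (\<chi> s. synth (P (\<mu> s)) n $ s)"

definition cost_policy :: "('a \<Rightarrow> real^'s) \<Rightarrow> ('s \<Rightarrow> 'a) \<Rightarrow> real^'s" where
  "cost_policy c \<mu> = (\<chi> s. c (\<mu> s) $ s)"

definition policy_value ::
    "real \<Rightarrow> ('a \<Rightarrow> real^'s^'s) \<Rightarrow> ('a \<Rightarrow> real^'s) \<Rightarrow> nat \<Rightarrow> ('s \<Rightarrow> 'a) \<Rightarrow> real^'s" where
  "policy_value \<gamma> P c n \<mu> =
     matrix_inv (mat 1 - \<gamma> *\<^sub>R l1_normalize (synth_policy P n \<mu>)) *v cost_policy c \<mu>"

text \<open>The argmin of the vector-valued map \<open>\<mu> \<mapsto> policy_value \<gamma> P c n \<mu>\<close>: the policy minimises the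
  cost from every state simultaneously.\<close>

definition optimal_policy ::
    "real \<Rightarrow> ('a \<Rightarrow> real^'s^'s) \<Rightarrow> ('a \<Rightarrow> real^'s) \<Rightarrow> nat \<Rightarrow> ('s \<Rightarrow> 'a) \<Rightarrow> bool" where
  "optimal_policy \<gamma> P c n \<mu> \<longleftrightarrow>
     (\<forall>\<nu> s. policy_value \<gamma> P c n \<mu> $ s \<le> policy_value \<gamma> P c n \<nu> $ s)"

text \<open>Cost of taking action \<open>a\<close> in state \<open>s\<close> and following \<open>\<mu>\<close> afterwards; the optimal
  \<open>Q\<close>-function is its minimum over the (finitely many) deterministic stationary policies.\<close>

definition policy_Q ::
    "real \<Rightarrow> ('a \<Rightarrow> real^'s^'s) \<Rightarrow> ('a \<Rightarrow> real^'s) \<Rightarrow> nat \<Rightarrow> ('s \<Rightarrow> 'a) \<Rightarrow> 's \<Rightarrow> 'a \<Rightarrow> real" where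
  "policy_Q \<gamma> P c n \<mu> s a =
     c a $ s + \<gamma> * (\<Sum>s'\<in>UNIV. env_trans P n a $ s $ s' * policy_value \<gamma> P c n \<mu> $ s')"

definition optimal_Q ::
    "real \<Rightarrow> ('a::finite \<Rightarrow> real^'s^'s) \<Rightarrow> ('a \<Rightarrow> real^'s) \<Rightarrow> nat \<Rightarrow> 's \<Rightarrow> 'a \<Rightarrow> real" where
  "optimal_Q \<gamma> P c n s a = (MIN \<mu>. policy_Q \<gamma> P c n \<mu> s a)"

text \<open>A run of \<open>Q\<close>-learning on the MDP with transition matrices \<open>T\<close> and costs \<open>c\<close>.
  \<open>F t\<close> is the information available before the \<open>t\<close>-th transition is drawn; \<open>S t\<close> and \<open>A t\<close> are
  the state and the action updated at time \<open>t\<close>, \<open>X t\<close> is the sampled successor state and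
  \<open>\<alpha> t\<close> the step size. The exploration scheme is left open: the run may follow a single trajectory
  (\<open>S (Suc t) = X t\<close>) or be restarted. The third last conjunct states that, conditionally on
  \<open>F t\<close>, the successor state has distribution \<open>T (A t) $ S t\<close>.\<close>

definition q_learning ::
    "'w measure \<Rightarrow> (nat \<Rightarrow> 'w measure) \<Rightarrow> real \<Rightarrow> ('a::finite \<Rightarrow> real^'s^'s) \<Rightarrow> ('a \<Rightarrow> real^'s)
     \<Rightarrow> (nat \<Rightarrow> 'w \<Rightarrow> 's) \<Rightarrow> (nat \<Rightarrow> 'w \<Rightarrow> 'a) \<Rightarrow> (nat \<Rightarrow> 'w \<Rightarrow> 's) \<Rightarrow> (nat \<Rightarrow> 'w \<Rightarrow> real)
     \<Rightarrow> (nat \<Rightarrow> 'w \<Rightarrow> 's \<Rightarrow> 'a \<Rightarrow> real) \<Rightarrow> bool" where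
  "q_learning M F \<gamma> T c S A X \<alpha> Q \<longleftrightarrow>
     filtration (space M) F \<and> (\<forall>t. subalgebra M (F t)) \<and>
     (\<forall>t. S t \<in> measurable (F t) (count_space UNIV)) \<and>
     (\<forall>t. A t \<in> measurable (F t) (count_space UNIV)) \<and>
     (\<forall>t. X t \<in> measurable (F (Suc t)) (count_space UNIV)) \<and>
     (\<forall>t. \<alpha> t \<in> borel_measurable (F t)) \<and>
     (\<forall>t. \<forall>\<omega>\<in>space M. 0 \<le> \<alpha> t \<omega> \<and> \<alpha> t \<omega> \<le> 1) \<and>
     (\<forall>t. \<forall>B\<in>sets (F t). \<forall>s a s'.
        measure M {\<omega>\<in>B. S t \<omega> = s \<and> A t \<omega> = a \<and> X t \<omega> = s'} =
        T a $ s $ s' * measure M {\<omega>\<in>B. S t \<omega> = s \<and> A t \<omega> = a}) \<and>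
     (\<forall>s a. (\<lambda>\<omega>. Q 0 \<omega> s a) \<in> borel_measurable (F 0)) \<and>
     (\<forall>t. \<forall>\<omega>\<in>space M. \<forall>s a.
        Q (Suc t) \<omega> s a =
          (if s = S t \<omega> \<and> a = A t \<omega>
           then (1 - \<alpha> t \<omega>) * Q t \<omega> s a
                + \<alpha> t \<omega> * (c a $ s + \<gamma> * (MIN a'. Q t \<omega> (X t \<omega>) a'))
           else Q t \<omega> s a))"

definition agreement_rate :: "('s::finite \<Rightarrow> 'a) \<Rightarrow> ('s \<Rightarrow> 'a) \<Rightarrow> real" where
  "agreement_rate \<pi> \<pi>' = 1 / real CARD('s) * (\<Sum>j\<in>UNIV. of_bool (\<pi> j = \<pi>' j))"

definition softmax :: "nat \<Rightarrow> (nat \<Rightarrow> real) \<Rightarrow> nat \<Rightarrow> real" where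
  "softmax K x n = exp (x n) / (\<Sum>i = 1..K. exp (x i))"

text \<open>The weights computed from the greedy policies \<open>p 1, \<dots>, p K\<close> of one time step.\<close>

definition esql_weight :: "nat \<Rightarrow> (nat \<Rightarrow> 's::finite \<Rightarrow> 'a) \<Rightarrow> nat \<Rightarrow> real" where
  "esql_weight K p = softmax K (\<lambda>n. agreement_rate (p 1) (p n))"

end

theory Submission
  imports Defs
begin

text \<open>
  Each environment is a finite discounted MDP, because the normalized synthetic matrices are
  row-stochastic. In a finite discounted MDP, \<open>v \<ge> c\<^sub>\<mu> + \<gamma> T\<^sub>\<mu> v\<close> implies \<open>v \<ge> V\<^sub>\<mu>\<close> (maximum principle).
  Applied to the greedy improvement of a policy that minimises the sum of the entries of its value,
  this yields an optimal policy; applied to a one-state deviation from the optimal policy \<open>\<pi>\<close>, it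
  shows that uniqueness of \<open>\<pi>\<close> makes \<open>\<pi> s\<close> the strict minimiser of the optimal \<open>Q\<close>-function at \<open>s\<close>.
  Hence the greedy policies of convergent \<open>Q\<close>-tables, and with them the weights, are eventually
  constant.
\<close>

section \<open>Stochasticity of the synthetic environments\<close>

lemma row_stochastic_pos_entry:
  assumes "row_stochastic A"
  obtains j where "0 < A $ i $ j"
proof -
  have "(\<Sum>j\<in>UNIV. A $ i $ j) > 0"
    using assms by (simp add: row_stochastic_def)
  then have "\<exists>j. 0 < A $ i $ j"
    by (metis leD not_le_imp_less sum_nonpos)
  then show thesis using that by blast
qed

lemma matrix_mult_nonneg:
  fixes A B :: "real^'s^'s"
  assumes "\<And>i j. 0 \<le> A $ i $ j" and "\<And>i j. 0 \<le> B $ i $ j"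
  shows "0 \<le> (A ** B) $ i $ j"
  using assms by (simp add: matrix_matrix_mult_def sum_nonneg)

lemma matrix_mult_pos_entry:
  fixes A B :: "real^'s^'s"
  assumes "\<And>i j. 0 \<le> A $ i $ j" and "\<And>i j. 0 \<le> B $ i $ j"
    and "0 < A $ i $ k" and "0 < B $ k $ j"
  shows "0 < (A ** B) $ i $ j"
proof -
  have "(\<Sum>k\<in>UNIV. A $ i $ k * B $ k $ j) > 0"
    by (rule sum_pos2[of _ k]) (use assms in auto)
  then show ?thesis by (simp add: matrix_matrix_mult_def)
qed

lemma matpow_nonneg:
  assumes "\<And>i j. 0 \<le> A $ i $ j"
  shows "0 \<le> matpow A k $ i $ j"
proof (induction k arbitrary: i j)
  case 0
  show ?case by (simp add: mat_def)
next
  case (Suc k)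
  then show ?case using assms by (simp add: matrix_mult_nonneg)
qed

lemma matpow_Suc_right: "matpow A (Suc k) = matpow A k ** A"
  by (induction k) (simp_all add: matrix_mul_assoc)

text \<open>A walk of \<open>k\<close> positive transitions from \<open>i\<close> can always be
  prolonged, since every row of \<open>A\<close> has a positive entry.\<close>

lemma matpow_pos_entry:
  assumes "row_stochastic A"
  obtains j where "0 < matpow A k $ i $ j"
proof -
  have nn: "\<And>i j. 0 \<le> A $ i $ j" using assms by (simp add: row_stochastic_def)
  have "\<exists>j. 0 < matpow A k $ i $ j"
  proof (induction k)
    case 0
    show ?case by (rule exI[of _ i]) (simp add: mat_def)
  next
    case (Suc k)
    then obtain l where l: "0 < matpow A k $ i $ l" by blast
    obtain j where "0 < A $ l $ j" using row_stochastic_pos_entry[OF assms] .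
    then have "0 < matpow A (Suc k) $ i $ j"
      unfolding matpow_Suc_right
      using matrix_mult_pos_entry[OF matpow_nonneg[OF nn] nn l] by blast
    then show ?case ..
  qed
  then show thesis using that by blast
qed

lemma synth_nonneg:
  assumes "row_stochastic A"
  shows "0 \<le> synth A n $ i $ j"
proof -
  have nn: "\<And>i j. 0 \<le> A $ i $ j" using assms by (simp add: row_stochastic_def)
  then have nt: "\<And>i j. 0 \<le> transpose A $ i $ j" by (simp add: transpose_def)
  show ?thesis
    using nn nt
    by (simp add: synth_def sum_nonneg matrix_mult_nonneg matpow_nonneg del: matpow.simps)
qed

text \<open>The summand \<open>k = 0\<close> contains the factor \<open>A A\<^sup>T\<close>, so following a positive transition
  forwards and then backwards gives a positive entry in every row.\<close>

lemma synth_pos_entry: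
  assumes "row_stochastic A" "1 \<le> n"
  obtains j where "0 < synth A n $ i $ j"
proof (cases "n = 1")
  case True
  then show thesis
    using row_stochastic_pos_entry[OF assms(1)] that by (metis synth_def)
next
  case False
  with assms obtain m where n: "n = Suc (Suc m)"
    by (metis One_nat_def Suc_le_D Suc_le_mono le0 not0_implies_Suc not_one_le_zero)
  have nn: "\<And>i j. 0 \<le> A $ i $ j" using assms by (simp add: row_stochastic_def)
  then have nt: "\<And>i j. 0 \<le> transpose A $ i $ j" by (simp add: transpose_def)
  obtain l where l: "0 < matpow A m $ i $ l" using matpow_pos_entry[OF assms(1)] .
  obtain k where k: "0 < A $ l $ k" using row_stochastic_pos_entry[OF assms(1)] .
  let ?f = "\<lambda>k. matpow A (n - k - 1) ** matpow (transpose A) (k + 1)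
           + matpow (transpose A) (n - k - 1) ** matpow A (k + 1)"
  have nf: "0 \<le> ?f k $ i $ l" for k
    using nn nt by (simp add: matrix_mult_nonneg matpow_nonneg del: matpow.simps)
  \<comment> \<open>The walk takes \<open>m\<close> steps from \<open>i\<close> to \<open>l\<close>,
    one more to \<open>k\<close>, and \<open>transpose A\<close> then leads back to
    \<open>l\<close>. As \<open>n - 0 - 1 = Suc m\<close>, this is the first product of the summand
    at 0.\<close>
  have "0 < matpow A (Suc m) $ i $ k"
    unfolding matpow_Suc_right
    by (rule matrix_mult_pos_entry[OF matpow_nonneg[OF nn] nn l k])
  then have "0 < (matpow A (Suc m) ** transpose A) $ i $ l"
    using k by (intro matrix_mult_pos_entry[OF matpow_nonneg[OF nn] nt]) (auto simp: transpose_def)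
  moreover have "0 \<le> (matpow (transpose A) (Suc m) ** A) $ i $ l"
    by (intro matrix_mult_nonneg matpow_nonneg nn nt)
  ultimately have "0 < ?f 0 $ i $ l"
    by (simp add: n del: matpow.simps(2)) (simp add: matpow_Suc_right)
  then have "0 < (\<Sum>k = 0..n - 2. ?f k $ i $ l)"
    using nf by (intro sum_pos2[of _ 0]) auto
  then have "0 < synth A n $ i $ l"
    using False by (simp add: synth_def)
  then show thesis using that by blast
qed

text \<open>Positive row sums ensure that the normalization never divides by zero.\<close>

lemma row_stochastic_env_trans:
  assumes "row_stochastic (P a)" "1 \<le> n"
  shows "row_stochastic (env_trans P n a)"
proof -
  have pos: "0 < (\<Sum>k\<in>UNIV. synth (P a) n $ i $ k)" for i
  proof -
    obtain j where "0 < synth (P a) n $ i $ j" using synth_pos_entry[OF assms] .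
    then show ?thesis using synth_nonneg[OF assms(1)] by (intro sum_pos2[of _ j]) auto
  qed
  show ?thesis
    using synth_nonneg[OF assms(1)] pos
    by (auto simp: row_stochastic_def env_trans_def l1_normalize_def less_imp_neq[symmetric]
        less_imp_le sum_divide_distrib[symmetric])
qed

section \<open>Discounted value functions\<close>

text \<open>At a maximal component \<open>m\<close> of \<open>d\<close>, averaging by
  \<open>B\<close> yields at most \<open>m\<close>. Hence \<open>m \<le> \<gamma> * m\<close>, which
  forces \<open>m \<le> 0\<close>.\<close>

lemma discounted_max_principle:
  fixes d :: "real^'s"
  assumes B: "row_stochastic B" and \<gamma>: "0 \<le> \<gamma>" "\<gamma> < 1"
    and sub: "\<And>s. d $ s \<le> \<gamma> * (B *v d) $ s"
  shows "d $ s \<le> 0"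
proof -
  define m where "m = Max (range (($) d))"
  have le: "d $ s \<le> m" for s unfolding m_def by simp
  obtain t where t: "m = d $ t"
    unfolding m_def using Max_in[of "range (($) d)"] by (metis finite finite_imageI UNIV_not_empty image_is_empty imageE)
  have "(B *v d) $ t \<le> (\<Sum>j\<in>UNIV. B $ t $ j * m)"
    unfolding matrix_vector_mult_def using B le
    by (auto intro!: sum_mono mult_left_mono simp: row_stochastic_def)
  also have "\<dots> = m"
    using B by (simp add: row_stochastic_def flip: sum_distrib_right)
  finally have "m \<le> \<gamma> * m"
    using sub[of t] t mult_left_mono[OF _ \<gamma>(1)] by fastforce
  then have "m \<le> 0" using \<gamma>(2)
    by (metis mult_less_cancel_right2 not_le_imp_less leD)
  then show ?thesis using le order_trans by blast
qed

text \<open>A kernel vector satisfies \<open>x = \<gamma> *\<^sub>R (B *v x)\<close>, so the maximum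
  principle applies to both \<open>x\<close> and \<open>- x\<close>.\<close>

lemma invertible_discounted:
  fixes B :: "real^'s^'s"
  assumes B: "row_stochastic B" and \<gamma>: "0 \<le> \<gamma>" "\<gamma> < 1"
  shows "invertible (mat 1 - \<gamma> *\<^sub>R B)"
proof -
  have "x = 0" if "(mat 1 - \<gamma> *\<^sub>R B) *v x = 0" for x
  proof -
    have x: "x = \<gamma> *\<^sub>R (B *v x)"
      using that by (simp add: matrix_vector_mult_diff_rdistrib scaleR_matrix_vector_assoc)
    have xs: "x $ s = \<gamma> * (B *v x) $ s" for s
      by (subst x) simp
    have "x $ s \<le> 0" for s
      using xs by (intro discounted_max_principle[OF B \<gamma>]) auto
    moreover have "(- x) $ s \<le> 0" for s
    proof (rule discounted_max_principle[OF B \<gamma>])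
      fix s
      have "B *v (- x) = - (B *v x)"
        by (simp add: matrix_vector_mult_def vec_eq_iff sum_negf)
      then show "(- x) $ s \<le> \<gamma> * (B *v (- x)) $ s" using xs[of s] by simp
    qed
    ultimately show ?thesis by (simp add: vec_eq_iff antisym)
  qed
  then show ?thesis
    using matrix_left_invertible_ker invertible_left_inverse by blast
qed

lemma matrix_mult_matrix_inv:
  fixes A :: "real^'s^'s"
  assumes "invertible A"
  shows "A ** matrix_inv A = mat 1"
  using someI_ex[OF assms[unfolded invertible_def]] by (simp add: matrix_inv_def)

locale discounted_env =
  fixes \<gamma> :: real and P :: "'a::finite \<Rightarrow> real^'s^'s" and c :: "'a \<Rightarrow> real^'s" and n :: nat
  assumes \<gamma>: "0 \<le> \<gamma>" "\<gamma> < 1"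
    and stochastic: "row_stochastic (env_trans P n a)"
begin

text \<open>The continuation value is an arbitrary vector, so that candidate values can be compared
  with policy values.\<close>

definition bellman :: "real^'s \<Rightarrow> 's \<Rightarrow> 'a \<Rightarrow> real" where
  "bellman v s a = c a $ s + \<gamma> * (\<Sum>s'\<in>UNIV. env_trans P n a $ s $ s' * v $ s')"

abbreviation V :: "('s \<Rightarrow> 'a) \<Rightarrow> real^'s" where
  "V \<mu> \<equiv> policy_value \<gamma> P c n \<mu>"

abbreviation optimal :: "('s \<Rightarrow> 'a) \<Rightarrow> bool" where
  "optimal \<equiv> optimal_policy \<gamma> P c n"

lemma policy_Q_eq_bellman: "policy_Q \<gamma> P c n \<mu> s a = bellman (V \<mu>) s a"
  by (simp add: policy_Q_def bellman_def)

lemma bellman_mono: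
  assumes "\<And>s. v $ s \<le> w $ s"
  shows "bellman v s a \<le> bellman w s a"
  using assms \<gamma> stochastic
  by (auto simp: bellman_def row_stochastic_def intro!: mult_left_mono sum_mono)

text \<open>Normalization acts on each row separately and so commutes with selecting rows by a
  policy.\<close>

lemma policy_matrix_row:
  "l1_normalize (synth_policy P n \<mu>) $ s = env_trans P n (\<mu> s) $ s"
  by (simp add: l1_normalize_def synth_policy_def env_trans_def)

lemma row_stochastic_policy: "row_stochastic (l1_normalize (synth_policy P n \<mu>))"
  using stochastic by (simp add: row_stochastic_def policy_matrix_row)

lemma bellman_policy:
  "bellman v s (\<mu> s) = cost_policy c \<mu> $ s + \<gamma> * (l1_normalize (synth_policy P n \<mu>) *v v) $ s"
  by (simp add: bellman_def cost_policy_def matrix_vector_mult_def policy_matrix_row)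

lemma policy_value_fixpoint: "V \<mu> $ s = bellman (V \<mu>) s (\<mu> s)"
proof -
  let ?B = "l1_normalize (synth_policy P n \<mu>)"
  have "(mat 1 - \<gamma> *\<^sub>R ?B) *v V \<mu> = cost_policy c \<mu>"
    using matrix_mult_matrix_inv[OF invertible_discounted[OF row_stochastic_policy \<gamma>]]
    by (simp add: policy_value_def matrix_vector_mul_assoc)
  then have "V \<mu> = cost_policy c \<mu> + \<gamma> *\<^sub>R (?B *v V \<mu>)"
    by (simp add: matrix_vector_mult_diff_rdistrib scaleR_matrix_vector_assoc algebra_simps)
  then have "V \<mu> $ s = (cost_policy c \<mu> + \<gamma> *\<^sub>R (?B *v V \<mu>)) $ s" by (rule arg_cong)
  then show ?thesis by (simp add: bellman_policy)
qed

text \<open>In the difference \<open>V \<mu> - v\<close> the costs cancel, which leaves the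
  inequality required by the maximum principle. The lower bound below exchanges the signs.\<close>

lemma policy_value_le:
  assumes "\<And>s. bellman v s (\<mu> s) \<le> v $ s"
  shows "V \<mu> $ s \<le> v $ s"
proof -
  have "(V \<mu> - v) $ s \<le> 0"
  proof (rule discounted_max_principle[OF row_stochastic_policy \<gamma>])
    fix s
    show "(V \<mu> - v) $ s \<le> \<gamma> * (l1_normalize (synth_policy P n \<mu>) *v (V \<mu> - v)) $ s"
      using assms[of s] policy_value_fixpoint[of \<mu> s]
      by (simp add: bellman_policy matrix_vector_mult_diff_distrib algebra_simps)
  qed
  then show ?thesis by simp
qed

lemma policy_value_ge:
  assumes "\<And>s. v $ s \<le> bellman v s (\<mu> s)"
  shows "v $ s \<le> V \<mu> $ s"
proof -
  have "(v - V \<mu>) $ s \<le> 0"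
  proof (rule discounted_max_principle[OF row_stochastic_policy \<gamma>])
    fix s
    show "(v - V \<mu>) $ s \<le> \<gamma> * (l1_normalize (synth_policy P n \<mu>) *v (v - V \<mu>)) $ s"
      using assms[of s] policy_value_fixpoint[of \<mu> s]
      by (simp add: bellman_policy matrix_vector_mult_diff_distrib algebra_simps)
  qed
  then show ?thesis by simp
qed

lemma ex_optimal_policy: "\<exists>\<mu>. optimal \<mu>"
proof -
  \<comment> \<open>Summing the entries turns the vector-valued minimization into a scalar one over
    finitely many policies.\<close>
  obtain \<mu> where \<mu>: "\<And>\<nu>. sum (($) (V \<mu>)) UNIV \<le> sum (($) (V \<nu>)) UNIV"
    using ex_min_if_finite[of "range (\<lambda>\<mu>. sum (($) (V \<mu>)) UNIV)"] by (force simp: not_less)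
  have "\<exists>a. \<forall>b. bellman (V \<mu>) s a \<le> bellman (V \<mu>) s b" for s
    using ex_min_if_finite[of "range (bellman (V \<mu>) s)"] by (force simp: not_less)
  then obtain \<mu>' where \<mu>': "\<And>s b. bellman (V \<mu>) s (\<mu>' s) \<le> bellman (V \<mu>) s b"
    by metis
  have le: "V \<mu>' $ s \<le> V \<mu> $ s" for s
    by (rule policy_value_le) (metis \<mu>' policy_value_fixpoint)
  \<comment> \<open>A strict decrease at any state would contradict the minimality of the
    sum.\<close>
  have "V \<mu>' $ s = V \<mu> $ s" for s
    using sum_mono_inv[of "($) (V \<mu>')" UNIV "($) (V \<mu>)" s] le \<mu>[of \<mu>']
    by (simp add: antisym sum_mono)
  then have eq: "V \<mu>' = V \<mu>" by (simp add: vec_eq_iff)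
  \<comment> \<open>Now \<open>V \<mu>\<close> is the value of its own greedy policy, so at each
    state it lies below its one-step lookahead for every action.\<close>
  have "V \<mu> $ s \<le> V \<nu> $ s" for \<nu> s
    by (rule policy_value_ge) (metis \<mu>' eq policy_value_fixpoint)
  then show ?thesis by (auto simp: optimal_policy_def)
qed

text \<open>By monotonicity of \<open>bellman\<close>, the single policy \<open>\<pi>\<close>
  attains the minimum for all state-action pairs at once.\<close>

lemma optimal_Q_eq:
  assumes "optimal \<pi>"
  shows "optimal_Q \<gamma> P c n s a = bellman (V \<pi>) s a"
  unfolding optimal_Q_def policy_Q_eq_bellman
  using assms by (intro Min_eqI) (auto simp: optimal_policy_def intro!: bellman_mono)

lemma optimal_Q_strict_min:
  assumes opt: "optimal \<pi>" and unique: "\<exists>\<^sub>\<le>\<^sub>1 \<mu>. optimal \<mu>" and ne: "a \<noteq> \<pi> s"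
  shows "optimal_Q \<gamma> P c n s (\<pi> s) < optimal_Q \<gamma> P c n s a"
proof (rule ccontr)
  assume "\<not> ?thesis"
  then have le: "bellman (V \<pi>) s a \<le> V \<pi> $ s"
    by (simp add: optimal_Q_eq[OF opt] policy_value_fixpoint[of \<pi> s])
  let ?\<mu> = "\<pi>(s := a)"
  \<comment> \<open>At \<open>s\<close> the premise is \<open>le\<close>; at all other states it is
    the fixed-point equation of \<open>\<pi>\<close>.\<close>
  have "V ?\<mu> $ s' \<le> V \<pi> $ s'" for s'
    by (rule policy_value_le) (use le policy_value_fixpoint[of \<pi>] in auto)
  then have "optimal ?\<mu>"
    using opt unfolding optimal_policy_def by (meson order_trans)
  then have "?\<mu> = \<pi>" using opt unique by (meson Uniq_D)
  then show False using ne by (metis fun_upd_same)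
qed

end

section \<open>Greedy policies of convergent Q-tables\<close>

text \<open>The finitely many strict inequalities of the limit eventually hold together for
  \<open>q t\<close>. From then on there are no ties, so the tie-breaking rule behind
  \<open>g\<close> is immaterial.\<close>

lemma eventually_arg_min_eq:
  fixes q :: "nat \<Rightarrow> 's::finite \<Rightarrow> 'a::finite \<Rightarrow> real"
  assumes lim: "\<And>s a. (\<lambda>t. q t s a) \<longlonglongrightarrow> l s a"
    and strict: "\<And>s a. a \<noteq> \<pi> s \<Longrightarrow> l s (\<pi> s) < l s a"
    and g: "\<And>t s. is_arg_min (q t s) (\<lambda>_. True) (g t s)"
  shows "\<forall>\<^sub>F t in sequentially. g t = \<pi>"
proof -
  have "\<forall>\<^sub>F t in sequentially. a \<noteq> \<pi> s \<longrightarrow> q t s (\<pi> s) < q t s a" for s a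
  proof (cases "a = \<pi> s")
    case False
    have "\<forall>\<^sub>F t in sequentially. 0 < q t s a - q t s (\<pi> s)"
      using tendsto_diff[OF lim lim] by (rule order_tendstoD) (use strict[OF False] in simp)
    then show ?thesis by eventually_elim simp
  qed simp
  then have "\<forall>\<^sub>F t in sequentially. \<forall>s a. a \<noteq> \<pi> s \<longrightarrow> q t s (\<pi> s) < q t s a"
    by (simp add: eventually_all_finite)
  then show ?thesis
    by eventually_elim (metis ext g is_arg_min_def)
qed

theorem proposition4:
  fixes P :: "'a::finite \<Rightarrow> real^'s^'s"
    and c :: "'a \<Rightarrow> real^'s"
    and \<gamma> :: real
    and K :: nat
    and M :: "'w measure"
    and F :: "nat \<Rightarrow> nat \<Rightarrow> 'w measure"
    and S X :: "nat \<Rightarrow> nat \<Rightarrow> 'w \<Rightarrow> 's"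
    and A :: "nat \<Rightarrow> nat \<Rightarrow> 'w \<Rightarrow> 'a"
    and \<alpha> :: "nat \<Rightarrow> nat \<Rightarrow> 'w \<Rightarrow> real"
    and Q :: "nat \<Rightarrow> nat \<Rightarrow> 'w \<Rightarrow> 's \<Rightarrow> 'a \<Rightarrow> real"
    and greedy :: "nat \<Rightarrow> nat \<Rightarrow> 'w \<Rightarrow> 's \<Rightarrow> 'a"
  assumes discount: "0 < \<gamma>" "\<gamma> < 1"
    and stochastic: "\<And>a. row_stochastic (P a)"
    and prob: "prob_space M"
    and run: "\<And>n. n \<in> {1..K} \<Longrightarrow>
      q_learning M (F n) \<gamma> (env_trans P n) c (S n) (A n) (X n) (\<alpha> n) (Q n)"
    and q_convergence: "\<And>n. n \<in> {1..K} \<Longrightarrow>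
      AE \<omega> in M. \<forall>s a. (\<lambda>t. Q n t \<omega> s a) \<longlonglongrightarrow> optimal_Q \<gamma> P c n s a"
    and greedy: "\<And>n t \<omega> s. n \<in> {1..K} \<Longrightarrow> \<omega> \<in> space M \<Longrightarrow>
      is_arg_min (Q n t \<omega> s) (\<lambda>_. True) (greedy n t \<omega> s)"
    and unique: "\<And>n. n \<in> {1..K} \<Longrightarrow> \<exists>\<^sub>\<le>\<^sub>1 \<mu>. optimal_policy \<gamma> P c n \<mu>"
  shows "\<exists>\<pi> :: nat \<Rightarrow> 's \<Rightarrow> 'a.
    (\<forall>n\<in>{1..K}. \<forall>\<mu>. optimal_policy \<gamma> P c n \<mu> \<longleftrightarrow> \<mu> = \<pi> n) \<and>
    (AE \<omega> in M. \<forall>n\<in>{1..K}.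
      (\<lambda>t. esql_weight K (\<lambda>i. greedy i t \<omega>) n) \<longlonglongrightarrow>
        exp (1 / real CARD('s) * (\<Sum>j\<in>UNIV. of_bool (\<pi> 1 j = \<pi> n j)))
        / (\<Sum>i = 1..K. exp (1 / real CARD('s) * (\<Sum>j\<in>UNIV. of_bool (\<pi> 1 j = \<pi> i j)))))"
proof -
  have env: "discounted_env \<gamma> P n" if "n \<in> {1..K}" for n
    using that discount stochastic
    by (auto simp: discounted_env_def intro!: row_stochastic_env_trans)
  then have "\<forall>n\<in>{1..K}. \<exists>\<mu>. optimal_policy \<gamma> P c n \<mu>"
    by (blast intro: discounted_env.ex_optimal_policy)
  then obtain \<pi> where \<pi>: "\<And>n. n \<in> {1..K} \<Longrightarrow> optimal_policy \<gamma> P c n (\<pi> n)"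
    by metis
  have "optimal_policy \<gamma> P c n \<mu> \<longleftrightarrow> \<mu> = \<pi> n" if "n \<in> {1..K}" for n \<mu>
    using \<pi>[OF that] unique[OF that] by (meson Uniq_D)
  moreover have "AE \<omega> in M. \<forall>n\<in>{1..K}.
      (\<lambda>t. esql_weight K (\<lambda>i. greedy i t \<omega>) n) \<longlonglongrightarrow> esql_weight K \<pi> n"
  proof -
    \<comment> \<open>The exceptional null sets of the finitely many environments are
      united.\<close>
    have "AE \<omega> in M. \<forall>n\<in>{1..K}. \<forall>s a. (\<lambda>t. Q n t \<omega> s a) \<longlonglongrightarrow> optimal_Q \<gamma> P c n s a"
      using q_convergence by (intro AE_finite_allI) auto
    with AE_space show ?thesis
    proof eventually_elim
      case (elim \<omega>)
      have "\<forall>\<^sub>F t in sequentially. greedy n t \<omega> = \<pi> n" if n: "n \<in> {1..K}" for n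
        using elim n
        by (intro eventually_arg_min_eq[where q = "\<lambda>t. Q n t \<omega>"
              and l = "optimal_Q \<gamma> P c n"]
            discounted_env.optimal_Q_strict_min[OF env[OF n] \<pi>[OF n] unique[OF n]]
            greedy) auto
      then have "\<forall>\<^sub>F t in sequentially. \<forall>n\<in>{1..K}. greedy n t \<omega> = \<pi> n"
        by (simp add: eventually_ball_finite)
      then have "\<forall>\<^sub>F t in sequentially.
          \<forall>n\<in>{1..K}. esql_weight K (\<lambda>i. greedy i t \<omega>) n = esql_weight K \<pi> n"
        \<comment> \<open>The weights also refer to policy 1, whose index lies in
          \<open>{1..K}\<close> as soon as some \<open>n\<close> does.\<close>
        by eventually_elim (auto simp: esql_weight_def softmax_def)
      then show ?case
        by (auto intro!: tendsto_eventually elim: eventually_mono)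
    qed
  qed
  ultimately show ?thesis
    unfolding esql_weight_def softmax_def agreement_rate_def by blast
qed

end
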